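(* Let $Q$ be an invertible complex $n\times n$ matrix. For a block matrix $\begin{pmatrix} A & B\\ C& D\end{pmatrix}\in\mathfrak{gl}_{2n}(\mathbb{C})$ (with $n\times n$ blocks) and $a\in U(\mathfrak{gl}_n)$ put $$\begin{pmatrix} A & B\\ C& D\end{pmatrix}\cdot a = Aa-a\,(Q^{-T}.D.Q^{T})+\mathrm{tr}(\psi(a).Q.B^{T})-\mathrm{tr}(\varphi(a).F_2.Q^{-T}.C)-\mathrm{tr}(\varphi(a).Q^{-T}.C)\,\mathrm{tr}(F).$$ This defines a $\mathfrak{gl}_{2n}(\mathbb{C})$-module structure on $U(\mathfrak{gl}_n)$.
   Context: Everything is over $\mathbb{C}$; $Q^{-T}=(Q^{-1})^{T}$. Let $\mathcal{A}=\mathfrak{gl}_n$ (identified with the top-left block subalgebra of $\mathfrak{gl}_{2n}$), with matrix units $e_{i,j}$, $1\le i,j\le n$; also write $\mathcal{A}$ for the associative algebra $\mathrm{Mat}_{n\times n}(\mathbb{C})$. Let $U(\mathcal{A})\otimes_{\mathbb{C}}\mathcal{A}\simeq \mathrm{Mat}_{n\times n}(U(\mathcal{A}))$ be the tensor product of unital associative algebras. The dot denotes the product in this algebra or in $\mathrm{Mat}_{n\times n}(\mathbb{C})$; a matrix $X\in\mathcal{A}$ is identified with $1\otimes X$ inside $U(\mathcal{A})\otimes\mathcal{A}$. Juxtaposition denotes the product in $U(\mathcal{A})$; in the terms $Aa$ and $a(Q^{-T}.D.Q^{T})$, the matrices $A$ and $Q^{-T}.D.Q^{T}$ are regarded as elements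 of $\mathfrak{gl}_n\subset U(\mathfrak{gl}_n)$. The trace is the linear map $\mathrm{tr}:U(\mathcal{A})\otimes\mathcal{A}\to U(\mathcal{A})$, $\mathrm{tr}(a\otimes X)=a\,\mathrm{tr}(X)$. The algebra homomorphisms $\varphi,\psi:U(\mathcal{A})\to U(\mathcal{A})\otimes\mathcal{A}$ are the extensions of the Lie algebra homomorphisms $\varphi(X)=X\otimes I+1\otimes X$ and $\psi(X)=X\otimes I-1\otimes X^{T}$ for $X\in\mathcal{A}$. Put $F=\sum_{i,j}e_{j,i}\otimes e_{i,j}$, so that $\mathrm{tr}(F)=\sum_i e_{i,i}\in U(\mathcal{A})$, and $F_2=\sum_{i,j,r=1}^{n}e_{i,r}e_{r,j}\otimes e_{j,i}\in U(\mathcal{A})\otimes\mathcal{A}$, so that $\mathrm{tr}(e_{i,j}.F_2)=\sum_{r}e_{i,r}e_{r,j}$. *)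

theory Defs
  imports "HOL-Analysis.Analysis" "HOL-Library.Poly_Mapping"
begin

section \<open>The Lie algebra \<open>gl\<^sub>n\<close>\<close>

type_synonym 'n gl = "complex^'n^'n"

definition gl_scale :: "complex \<Rightarrow> ('n::finite) gl \<Rightarrow> 'n gl"
  where "gl_scale c X = (\<chi> i j. c * X $ i $ j)"

definition gl_bracket :: "('n::finite) gl \<Rightarrow> 'n gl \<Rightarrow> 'n gl"
  where "gl_bracket X Y = X ** Y - Y ** X"

definition mat_unit :: "'n \<Rightarrow> 'n \<Rightarrow> ('n::finite) gl"
  where "mat_unit i j = (\<chi> k l. if k = i \<and> l = j then 1 else 0)"

lemma vector_space_gl_scale: "vector_space gl_scale"
  by unfold_locales (simp_all add: gl_scale_def vec_eq_iff algebra_simps)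

text \<open>
  The structure of a module over the Lie algebra of complex square matrices indexed by \<open>'m\<close>
  on a complex vector space with scalar multiplication \<open>scl\<close>: a bilinear action
  compatible with the bracket.
\<close>

definition gl_module ::
    "(complex \<Rightarrow> 'v \<Rightarrow> 'v) \<Rightarrow> (('m::finite) gl \<Rightarrow> 'v \<Rightarrow> 'v::ab_group_add) \<Rightarrow> bool"
  where "gl_module scl act \<longleftrightarrow>
    vector_space scl \<and>
    (\<forall>v. Vector_Spaces.linear gl_scale scl (\<lambda>X. act X v)) \<and>
    (\<forall>X. Vector_Spaces.linear scl scl (act X)) \<and>
    (\<forall>X Y v. act (gl_bracket X Y) v = act X (act Y v) - act Y (act X v))"


section \<open>The free associative algebra on the set of matrices\<close>

text \<open>
  Words form the free monoid, written additively because finitely supported functions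
  on an additive monoid carry the convolution product.
\<close>

datatype 'a word_monoid = Word (letters: "'a list")

instantiation word_monoid :: (type) monoid_add
begin

definition zero_word_monoid :: "'a word_monoid" where "0 = Word []"

definition plus_word_monoid :: "'a word_monoid \<Rightarrow> 'a word_monoid \<Rightarrow> 'a word_monoid"
  where "v + w = Word (letters v @ letters w)"

instance
  by standard (simp_all add: zero_word_monoid_def plus_word_monoid_def)

end

type_synonym 'n free_alg = "'n gl word_monoid \<Rightarrow>\<^sub>0 complex"

definition free_gen :: "('n::finite) gl \<Rightarrow> 'n free_alg"
  where "free_gen X = Poly_Mapping.single (Word [X]) 1"

definition free_const :: "complex \<Rightarrow> ('n::finite) free_alg"
  where "free_const c = Poly_Mapping.single 0 c"

text \<open>
  The two-sided ideal whose quotient is the enveloping algebra. The first two families of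
  generators turn the free algebra into the tensor algebra of the vector space of matrices,
  the third imposes the bracket.
\<close>

inductive_set env_ideal :: "('n::finite) free_alg set" where
  add_rel: "free_gen (X + Y) - free_gen X - free_gen Y \<in> env_ideal"
| scale_rel: "free_gen (gl_scale c X) - free_const c * free_gen X \<in> env_ideal"
| bracket_rel: "free_gen X * free_gen Y - free_gen Y * free_gen X - free_gen (gl_bracket X Y) \<in> env_ideal"
| add: "p \<in> env_ideal \<Longrightarrow> q \<in> env_ideal \<Longrightarrow> p + q \<in> env_ideal"
| mult: "p \<in> env_ideal \<Longrightarrow> a * p * b \<in> env_ideal"

lemma env_ideal_zero: "0 \<in> env_ideal"
  using env_ideal.mult[OF env_ideal.add_rel, of 0] by simp

lemma env_ideal_mult_left: "p \<in> env_ideal \<Longrightarrow> a * p \<in> env_ideal"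
  using env_ideal.mult[of p a 1] by simp

lemma env_ideal_mult_right: "p \<in> env_ideal \<Longrightarrow> p * b \<in> env_ideal"
  using env_ideal.mult[of p 1 b] by simp

lemma env_ideal_uminus: "p \<in> env_ideal \<Longrightarrow> - p \<in> env_ideal"
  using env_ideal_mult_left[of p "-1"] by simp

lemma env_ideal_minus_swap: "p - q \<in> env_ideal \<Longrightarrow> q - p \<in> env_ideal"
  using env_ideal_uminus[of "p - q"] by simp

lemma free_gen_mult_single: "free_gen X * Poly_Mapping.single (Word ws) c = Poly_Mapping.single (Word (X # ws)) c"
  by (simp add: free_gen_def mult_single plus_word_monoid_def)

lemma free_const_mult: "free_const c * free_const d = free_const (c * d)"
  by (simp add: free_const_def mult_single)

lemma free_const_1: "free_const 1 = 1"
  by (simp add: free_const_def)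

lemma free_alg_sum: "(p::('n::finite) free_alg) = (\<Sum>w\<in>Poly_Mapping.keys p. Poly_Mapping.single w (Poly_Mapping.lookup p w))"
  by (rule poly_mapping_eqI) (simp add: lookup_sum lookup_single in_keys_iff when_def)

lemma free_alg_induct [case_names single add]:
  fixes p :: "('n::finite) free_alg"
  assumes single: "\<And>w c. P (Poly_Mapping.single w c)"
    and add: "\<And>p q. P p \<Longrightarrow> P q \<Longrightarrow> P (p + q)"
  shows "P p"
proof -
  have "P 0" using single[of 0 0] by simp
  have "P (\<Sum>w\<in>S. Poly_Mapping.single w (Poly_Mapping.lookup p w))" if "finite S" for S
    using that by (induction S rule: finite_induct) (auto intro: single add \<open>P 0\<close>)
  from this[of "Poly_Mapping.keys p"] show ?thesis using free_alg_sum[of p] by simp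
qed

lemma free_const_commute: "free_const c * p = p * free_const c"
  by (induction p rule: free_alg_induct)
    (simp_all add: free_const_def mult_single distrib_left distrib_right mult.commute)


section \<open>The universal enveloping algebra \<open>U(gl\<^sub>n)\<close>\<close>

definition env_rel :: "('n::finite) free_alg \<Rightarrow> 'n free_alg \<Rightarrow> bool"
  where "env_rel p q \<longleftrightarrow> p - q \<in> env_ideal"

lemma equivp_env_rel: "equivp (env_rel :: (('n::finite) free_alg) \<Rightarrow> _)"
proof (rule equivpI)
  show "reflp env_rel" by (simp add: reflp_def env_rel_def env_ideal_zero)
  show "symp env_rel" by (auto simp: symp_def env_rel_def intro: env_ideal_minus_swap)
  show "transp (env_rel :: 'n free_alg \<Rightarrow> _)"
  proof (rule transpI)
    fix p q r :: "'n free_alg" assume "env_rel p q" "env_rel q r"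
    then show "env_rel p r" using env_ideal.add[of "p - q" "q - r"] by (simp add: env_rel_def)
  qed
qed

lemma env_rel_refl: "env_rel p p"
  using equivp_env_rel by (rule equivp_reflp)

quotient_type (overloaded) 'n ugl = "('n::finite) free_alg" / env_rel
  by (rule equivp_env_rel)

text \<open>
  An algebra over the complex numbers, with operations given explicitly so that it also
  covers the matrix product, which is not the type class multiplication of matrices.
\<close>

locale unital_algebra = vector_space scl
  for scl :: "complex \<Rightarrow> 'b::ab_group_add \<Rightarrow> 'b" +
  fixes mul :: "'b \<Rightarrow> 'b \<Rightarrow> 'b" and one :: 'b
  assumes mul_assoc: "mul (mul x y) z = mul x (mul y z)"
    and one_mul: "mul one x = x"
    and mul_one: "mul x one = x"
    and mul_add_left: "mul (x + y) z = mul x z + mul y z"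
    and mul_add_right: "mul x (y + z) = mul x y + mul x z"
    and mul_scl_left: "mul (scl c x) y = scl c (mul x y)"
    and mul_scl_right: "mul x (scl c y) = scl c (mul x y)"
begin

definition ev_word :: "(('n::finite) gl \<Rightarrow> 'b) \<Rightarrow> 'n gl word_monoid \<Rightarrow> 'b"
  where "ev_word f w = foldr (\<lambda>X b. mul (f X) b) (letters w) one"

definition ev :: "(('n::finite) gl \<Rightarrow> 'b) \<Rightarrow> 'n free_alg \<Rightarrow> 'b"
  where "ev f p = (\<Sum>w\<in>Poly_Mapping.keys p. scl (Poly_Mapping.lookup p w) (ev_word f w))"

definition lie_hom :: "(('n::finite) gl \<Rightarrow> 'b) \<Rightarrow> bool"
  where "lie_hom f \<longleftrightarrow> (\<forall>X Y. f (X + Y) = f X + f Y) \<and> (\<forall>c X. f (gl_scale c X) = scl c (f X)) \<and>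
    (\<forall>X Y. f (gl_bracket X Y) = mul (f X) (f Y) - mul (f Y) (f X))"

lemma mul_zero_left: "mul 0 y = 0"
  using mul_add_left[of 0 0 y] by simp

lemma mul_zero_right: "mul y 0 = 0"
  using mul_add_right[of y 0 0] by simp

lemma ev_word_add: "ev_word f (v + w) = mul (ev_word f v) (ev_word f w)"
proof -
  have "foldr (\<lambda>X b. mul (f X) b) (xs @ ys) one
      = mul (foldr (\<lambda>X b. mul (f X) b) xs one) (foldr (\<lambda>X b. mul (f X) b) ys one)" for xs ys
    by (induction xs) (simp_all add: one_mul mul_assoc)
  then show ?thesis by (simp add: ev_word_def plus_word_monoid_def)
qed

lemma ev_superset:
  assumes "finite S" "Poly_Mapping.keys p \<subseteq> S"
  shows "ev f p = (\<Sum>w\<in>S. scl (Poly_Mapping.lookup p w) (ev_word f w))"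
  unfolding ev_def using assms by (intro sum.mono_neutral_left) (auto simp: in_keys_iff)

lemma ev_zero: "ev f 0 = 0"
  by (simp add: ev_def)

lemma ev_add: "ev f (p + q) = ev f p + ev f q"
proof -
  let ?S = "Poly_Mapping.keys p \<union> Poly_Mapping.keys q"
  have "Poly_Mapping.keys (p + q) \<subseteq> ?S" by (rule keys_add)
  then show ?thesis
    by (simp add: ev_superset[of ?S] lookup_add scale_left_distrib sum.distrib)
qed

lemma ev_uminus: "ev f (- p) = - ev f p"
  using ev_add[of f p "- p"] by (simp add: ev_zero add_eq_0_iff)

lemma ev_diff: "ev f (p - q) = ev f p - ev f q"
  using ev_add[of f p "- q"] by (simp add: ev_uminus)

lemma ev_single: "ev f (Poly_Mapping.single w c) = scl c (ev_word f w)"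
  by (simp add: ev_superset[of "{w}"])

lemma ev_mult: "ev f (p * q) = mul (ev f p) (ev f q)"
proof (induction p rule: free_alg_induct)
  case (single v c)
  show ?case
  proof (induction q rule: free_alg_induct)
    case (single w d)
    show ?case
      by (simp add: mult_single ev_single ev_word_add mul_scl_left mul_scl_right)
  next
    case (add p q)
    then show ?case by (simp add: distrib_left ev_add mul_add_right)
  qed
next
  case (add p p')
  then show ?case by (simp add: distrib_right ev_add mul_add_left)
qed

lemma ev_const: "ev f (free_const c) = scl c one"
  by (simp add: free_const_def ev_single ev_word_def zero_word_monoid_def)

lemma ev_gen: "ev f (free_gen X) = f X"
  by (simp add: free_gen_def ev_single ev_word_def mul_one)

lemma ev_ideal:
  assumes "lie_hom f" "p \<in> env_ideal"
  shows "ev f p = 0"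
  using assms(2)
  by induction
    (use assms(1) in \<open>simp_all add: lie_hom_def ev_diff ev_add ev_mult ev_gen ev_const
      mul_scl_left one_mul mul_zero_left mul_zero_right\<close>)

end

interpretation complex_alg: unital_algebra "(*) :: complex \<Rightarrow> complex \<Rightarrow> complex" "(*)" 1
  by unfold_locales (simp_all add: algebra_simps)

lemma env_ideal_proper: "1 \<notin> env_ideal"
proof
  assume "(1 :: 'a free_alg) \<in> env_ideal"
  then have "complex_alg.ev (\<lambda>_. 0) (1 :: 'a free_alg) = 0"
    by (rule complex_alg.ev_ideal[rotated]) (simp add: complex_alg.lie_hom_def)
  moreover have "complex_alg.ev (\<lambda>_. 0) (1 :: 'a free_alg) = 1"
    using complex_alg.ev_const[of "\<lambda>_. 0" 1] by (simp add: free_const_1)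
  ultimately show False by simp
qed

instantiation ugl :: (finite) ring_1
begin

lift_definition zero_ugl :: "'a ugl" is 0 .

lift_definition one_ugl :: "'a ugl" is 1 .

lift_definition plus_ugl :: "'a ugl \<Rightarrow> 'a ugl \<Rightarrow> 'a ugl" is "(+)"
  unfolding env_rel_def by (drule (1) env_ideal.add) (simp add: algebra_simps)

lift_definition uminus_ugl :: "'a ugl \<Rightarrow> 'a ugl" is uminus
  unfolding env_rel_def by (drule env_ideal_uminus) (simp add: algebra_simps)

lift_definition minus_ugl :: "'a ugl \<Rightarrow> 'a ugl \<Rightarrow> 'a ugl" is "(-)"
  unfolding env_rel_def by (drule env_ideal.add, erule env_ideal_uminus) (simp add: algebra_simps)

lift_definition times_ugl :: "'a ugl \<Rightarrow> 'a ugl \<Rightarrow> 'a ugl" is "(*)"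
proof -
  fix p q r s :: "'a free_alg"
  assume "env_rel p q" "env_rel r s"
  then have "(p - q) * r + q * (r - s) \<in> env_ideal"
    unfolding env_rel_def by (intro env_ideal.add env_ideal_mult_left env_ideal_mult_right)
  then show "env_rel (p * r) (q * s)"
    by (simp add: env_rel_def algebra_simps)
qed

instance
proof
  fix a b c :: "'a ugl"
  show "a * b * c = a * (b * c)" by transfer (simp add: env_rel_refl mult.assoc)
  show "1 * a = a" by transfer (simp add: env_rel_refl)
  show "a * 1 = a" by transfer (simp add: env_rel_refl)
  show "a + b + c = a + (b + c)" by transfer (simp add: env_rel_refl add.assoc)
  show "a + b = b + a" by transfer (simp add: env_rel_refl add.commute)
  show "0 + a = a" by transfer (simp add: env_rel_refl)
  show "- a + a = 0" by transfer (simp add: env_rel_refl)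
  show "a - b = a + - b" by transfer (simp add: env_rel_refl)
  show "(a + b) * c = a * c + b * c" by transfer (simp add: env_rel_refl distrib_right)
  show "a * (b + c) = a * b + a * c" by transfer (simp add: env_rel_refl distrib_left)
  show "(0::'a ugl) \<noteq> 1"
  proof transfer
    show "\<not> env_rel 0 (1 :: 'a free_alg)"
      using env_ideal_minus_swap[of 0 "1 :: 'a free_alg"] env_ideal_proper unfolding env_rel_def
      by (metis diff_zero)
  qed
qed

end

lift_definition ugl_scale :: "complex \<Rightarrow> ('n::finite) ugl \<Rightarrow> 'n ugl"
  is "\<lambda>c p. free_const c * p"
  unfolding env_rel_def by (drule env_ideal_mult_left) (simp add: algebra_simps)

text \<open>The canonical map from the Lie algebra to its enveloping algebra.\<close>

lift_definition \<iota> :: "('n::finite) gl \<Rightarrow> 'n ugl" is free_gen .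

lemma \<iota>_add: "\<iota> (X + Y) = \<iota> X + \<iota> Y"
proof transfer
  fix X Y :: "'a gl"
  show "env_rel (free_gen (X + Y)) (free_gen X + free_gen Y)"
    using env_ideal.add_rel[of X Y] by (simp add: env_rel_def diff_diff_eq)
qed

lemma \<iota>_scale: "\<iota> (gl_scale c X) = ugl_scale c (\<iota> X)"
  by transfer (simp add: env_rel_def env_ideal.scale_rel)

lemma \<iota>_bracket: "\<iota> (gl_bracket X Y) = \<iota> X * \<iota> Y - \<iota> Y * \<iota> X"
proof transfer
  fix X Y :: "'a gl"
  show "env_rel (free_gen (gl_bracket X Y)) (free_gen X * free_gen Y - free_gen Y * free_gen X)"
    unfolding env_rel_def by (rule env_ideal_minus_swap[OF env_ideal.bracket_rel])
qed

lemma free_const_add: "free_const (c + d) = free_const c + free_const d"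
  by (simp add: free_const_def single_add)

interpretation ugl_alg: unital_algebra "ugl_scale :: complex \<Rightarrow> ('n::finite) ugl \<Rightarrow> 'n ugl" "(*)" 1
proof unfold_locales
  fix c :: complex and x y :: "'n ugl"
  show "x * ugl_scale c y = ugl_scale c (x * y)"
  proof transfer
    fix c and p q :: "'n free_alg"
    have "p * (free_const c * q) = free_const c * (p * q)"
      by (metis mult.assoc free_const_commute)
    then show "env_rel (p * (free_const c * q)) (free_const c * (p * q))"
      by (simp add: env_rel_refl)
  qed
  fix a b :: complex and z :: "'n ugl"
  show "ugl_scale a (x + y) = ugl_scale a x + ugl_scale a y"
    by transfer (simp add: env_rel_refl distrib_left)
  show "ugl_scale (a + b) x = ugl_scale a x + ugl_scale b x"
    by transfer (simp add: env_rel_refl free_const_add distrib_right)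
  show "ugl_scale a (ugl_scale b x) = ugl_scale (a * b) x"
    by transfer (simp add: env_rel_refl free_const_mult[symmetric] mult.assoc)
  show "ugl_scale 1 x = x"
    by transfer (simp add: env_rel_refl free_const_1)
  show "ugl_scale c x * y = ugl_scale c (x * y)"
    by transfer (simp add: env_rel_refl mult.assoc)
qed (simp_all add: mult.assoc distrib_left distrib_right)


section \<open>The algebra \<open>U(gl\<^sub>n) \<otimes> gl\<^sub>n\<close>, identified with matrices over \<open>U(gl\<^sub>n)\<close>\<close>

type_synonym 'n ugl_mat = "'n ugl^'n^'n"

definition tensor :: "('n::finite) ugl \<Rightarrow> 'n gl \<Rightarrow> 'n ugl_mat"  (infix "\<otimes>\<^sub>U" 72)
  where "a \<otimes>\<^sub>U X = (\<chi> i j. ugl_scale (X $ i $ j) a)"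

definition ugl_mat_scale :: "complex \<Rightarrow> ('n::finite) ugl_mat \<Rightarrow> 'n ugl_mat"
  where "ugl_mat_scale c M = (\<chi> i j. ugl_scale c (M $ i $ j))"

lemma ugl_scale_sum_left: "ugl_scale (sum f S) a = (\<Sum>i\<in>S. ugl_scale (f i) a)"
  by (rule ugl_alg.scale_sum_left)

lemma tensor_mult: "(a \<otimes>\<^sub>U X) ** (b \<otimes>\<^sub>U Y) = (a * b) \<otimes>\<^sub>U (X ** Y)"
  by (simp add: tensor_def matrix_matrix_mult_def vec_eq_iff ugl_scale_sum_left
      ugl_alg.mul_scl_left ugl_alg.mul_scl_right mult.commute)

lemma trace_tensor: "trace (a \<otimes>\<^sub>U X) = ugl_scale (trace X) a"
  by (simp add: tensor_def trace_def ugl_scale_sum_left)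

lemma tensor_one_mat: "1 \<otimes>\<^sub>U mat 1 = mat 1"
  by (simp add: tensor_def mat_def vec_eq_iff)

interpretation ugl_mat_alg: unital_algebra
  "ugl_mat_scale :: complex \<Rightarrow> ('n::finite) ugl_mat \<Rightarrow> 'n ugl_mat" "(**)" "mat 1"
proof unfold_locales
  fix c :: complex and x y z :: "'n ugl_mat"
  show "x ** y ** z = x ** (y ** z)" by (simp add: matrix_mul_assoc)
  show "x ** (y + z) = x ** y + x ** z" by (rule matrix_add_ldistrib)
  show "(x + y) ** z = x ** z + y ** z"
    by (simp add: matrix_matrix_mult_def vec_eq_iff distrib_right sum.distrib)
  show "ugl_mat_scale c x ** y = ugl_mat_scale c (x ** y)"
    by (simp add: ugl_mat_scale_def matrix_matrix_mult_def vec_eq_iff ugl_alg.mul_scl_left ugl_alg.scale_sum_right)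
  show "x ** ugl_mat_scale c y = ugl_mat_scale c (x ** y)"
    by (simp add: ugl_mat_scale_def matrix_matrix_mult_def vec_eq_iff ugl_alg.mul_scl_right ugl_alg.scale_sum_right)
qed (simp_all add: ugl_mat_scale_def vec_eq_iff ugl_alg.scale_left_distrib ugl_alg.scale_right_distrib)

definition ugl_mat_hom :: "(('n::finite) ugl \<Rightarrow> 'n ugl_mat) \<Rightarrow> bool"
  where "ugl_mat_hom h \<longleftrightarrow>
    (\<forall>a b. h (a + b) = h a + h b) \<and> (\<forall>c a. h (ugl_scale c a) = ugl_mat_scale c (h a)) \<and>
    h 1 = mat 1 \<and> (\<forall>a b. h (a * b) = h a ** h b)"

text \<open>
  The unital algebra homomorphism extending \<open>f\<close>; it exists and is unique whenever \<open>f\<close> is a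
  Lie algebra homomorphism, see \<open>ugl_extend_ex1\<close>.
\<close>

definition ugl_extend :: "(('n::finite) gl \<Rightarrow> 'n ugl_mat) \<Rightarrow> 'n ugl \<Rightarrow> 'n ugl_mat"
  where "ugl_extend f = (THE h. ugl_mat_hom h \<and> (\<forall>X. h (\<iota> X) = f X))"

lemma ugl_abs_cases: obtains p where "a = abs_ugl p"
  using ugl.abs_induct[of "\<lambda>a. \<exists>p. a = abs_ugl p" a] by blast

lemma ugl_induct [case_names const gen add]:
  fixes a :: "('n::finite) ugl"
  assumes const: "\<And>c. P (ugl_scale c 1)"
    and gen: "\<And>X a. P a \<Longrightarrow> P (\<iota> X * a)"
    and add: "\<And>a b. P a \<Longrightarrow> P b \<Longrightarrow> P (a + b)"
  shows "P a"
proof -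
  have "P (abs_ugl p)" for p
  proof (induction p rule: free_alg_induct)
    case (single w c)
    have "P (abs_ugl (Poly_Mapping.single (Word ws) c))" for ws
    proof (induction ws)
      case Nil
      then show ?case
        using const[of c] by (simp add: one_ugl_def ugl_scale.abs_eq free_const_def zero_word_monoid_def)
    next
      case (Cons X ws)
      then show ?case
        using gen[OF Cons.IH, of X] by (simp add: \<iota>_def times_ugl.abs_eq free_gen_mult_single)
    qed
    then show ?case by (cases w) simp
  next
    case (add p q)
    then show ?case using assms(3)[of "abs_ugl p" "abs_ugl q"] by (simp add: plus_ugl.abs_eq)
  qed
  then show ?thesis by (metis ugl_abs_cases)
qed

lemma ugl_extend_ex1:
  fixes f :: "('n::finite) gl \<Rightarrow> 'n ugl_mat"
  assumes "ugl_mat_alg.lie_hom f"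
  shows "\<exists>!h. ugl_mat_hom h \<and> (\<forall>X. h (\<iota> X) = f X)"
proof (rule ex_ex1I)
  define h where "h a = ugl_mat_alg.ev f (rep_ugl a)" for a
  have h_abs: "h (abs_ugl p) = ugl_mat_alg.ev f p" for p
  proof -
    have "env_rel (rep_ugl (abs_ugl p)) p"
      by (rule Quotient3_rep_abs[OF Quotient3_ugl]) (rule env_rel_refl)
    then have "ugl_mat_alg.ev f (rep_ugl (abs_ugl p) - p) = 0"
      unfolding env_rel_def by (rule ugl_mat_alg.ev_ideal[OF assms])
    then show ?thesis by (simp add: h_def ugl_mat_alg.ev_diff)
  qed
  have "h (a + b) = h a + h b" "h (a * b) = h a ** h b" for a b
    by (rule ugl_abs_cases[of a], rule ugl_abs_cases[of b],
        simp add: plus_ugl.abs_eq times_ugl.abs_eq h_abs ugl_mat_alg.ev_add ugl_mat_alg.ev_mult)+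
  moreover have "h (ugl_scale c a) = ugl_mat_scale c (h a)" for c a
    by (rule ugl_abs_cases[of a]) (simp add: ugl_scale.abs_eq h_abs ugl_mat_alg.ev_mult
        ugl_mat_alg.ev_const ugl_mat_alg.mul_scl_left)
  moreover have "h 1 = mat 1"
    using ugl_mat_alg.ev_const[of f 1] by (simp add: one_ugl_def h_abs free_const_1)
  ultimately have "ugl_mat_hom h" by (simp add: ugl_mat_hom_def)
  moreover have "\<forall>X. h (\<iota> X) = f X"
    by (simp add: \<iota>.abs_eq h_abs ugl_mat_alg.ev_gen)
  ultimately show "\<exists>h. ugl_mat_hom h \<and> (\<forall>X. h (\<iota> X) = f X)" by blast
next
  fix g h
  assume g: "ugl_mat_hom g \<and> (\<forall>X. g (\<iota> X) = f X)" and h: "ugl_mat_hom h \<and> (\<forall>X. h (\<iota> X) = f X)"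
  show "g = h"
  proof
    fix a show "g a = h a"
      by (induction a rule: ugl_induct) (use g h in \<open>simp_all add: ugl_mat_hom_def\<close>)
  qed
qed

lemma ugl_extend:
  assumes "ugl_mat_alg.lie_hom f"
  shows "ugl_mat_hom (ugl_extend f)" "ugl_extend f (\<iota> X) = f X"
  using theI'[OF ugl_extend_ex1[OF assms]] unfolding ugl_extend_def by auto

definition \<phi> :: "('n::finite) ugl \<Rightarrow> 'n ugl_mat"
  where "\<phi> = ugl_extend (\<lambda>X. \<iota> X \<otimes>\<^sub>U mat 1 + 1 \<otimes>\<^sub>U X)"

definition \<psi> :: "('n::finite) ugl \<Rightarrow> 'n ugl_mat"
  where "\<psi> = ugl_extend (\<lambda>X. \<iota> X \<otimes>\<^sub>U mat 1 - 1 \<otimes>\<^sub>U transpose X)"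

lemma tensor_add_left: "(a + b) \<otimes>\<^sub>U X = a \<otimes>\<^sub>U X + b \<otimes>\<^sub>U X"
  by (simp add: tensor_def vec_eq_iff ugl_alg.scale_right_distrib)

lemma tensor_diff_left: "(a - b) \<otimes>\<^sub>U X = a \<otimes>\<^sub>U X - b \<otimes>\<^sub>U X"
  by (simp add: tensor_def vec_eq_iff ugl_alg.scale_right_diff_distrib)

lemma tensor_add_right: "a \<otimes>\<^sub>U (X + Y) = a \<otimes>\<^sub>U X + a \<otimes>\<^sub>U Y"
  by (simp add: tensor_def vec_eq_iff ugl_alg.scale_left_distrib)

lemma tensor_diff_right: "a \<otimes>\<^sub>U (X - Y) = a \<otimes>\<^sub>U X - a \<otimes>\<^sub>U Y"
  by (simp add: tensor_def vec_eq_iff ugl_alg.scale_left_diff_distrib)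

lemma tensor_scale_left: "ugl_scale c a \<otimes>\<^sub>U X = ugl_mat_scale c (a \<otimes>\<^sub>U X)"
  by (simp add: tensor_def ugl_mat_scale_def vec_eq_iff mult.commute)

lemma tensor_scale_right: "a \<otimes>\<^sub>U gl_scale c X = ugl_mat_scale c (a \<otimes>\<^sub>U X)"
  by (simp add: tensor_def ugl_mat_scale_def gl_scale_def vec_eq_iff)

lemma mat_add_rdistrib: "((A::('n::finite) ugl_mat) + B) ** (C::'n ugl_mat) = A ** C + B ** C"
  by (rule ugl_mat_alg.mul_add_left)

lemma mat_diff_ldistrib: "(A::('n::finite) ugl_mat) ** ((B::'n ugl_mat) - C) = A ** B - A ** C"
  using matrix_add_ldistrib[of A "B - C" C] by (simp add: algebra_simps)

lemma mat_diff_rdistrib: "((A::('n::finite) ugl_mat) - B) ** (C::'n ugl_mat) = A ** C - B ** C"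
  using mat_add_rdistrib[of "A - B" B C] by (simp add: algebra_simps)

lemma \<phi>_lie_hom: "ugl_mat_alg.lie_hom (\<lambda>X. \<iota> X \<otimes>\<^sub>U mat 1 + 1 \<otimes>\<^sub>U X)"
  unfolding ugl_mat_alg.lie_hom_def
proof (intro conjI allI)
  fix X Y :: "'a gl" and c
  show "\<iota> (X + Y) \<otimes>\<^sub>U mat 1 + 1 \<otimes>\<^sub>U (X + Y)
      = \<iota> X \<otimes>\<^sub>U mat 1 + 1 \<otimes>\<^sub>U X + (\<iota> Y \<otimes>\<^sub>U mat 1 + 1 \<otimes>\<^sub>U Y)"
    by (simp add: \<iota>_add tensor_add_left tensor_add_right)
  show "\<iota> (gl_scale c X) \<otimes>\<^sub>U mat 1 + 1 \<otimes>\<^sub>U gl_scale c X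
      = ugl_mat_scale c (\<iota> X \<otimes>\<^sub>U mat 1 + 1 \<otimes>\<^sub>U X)"
    by (simp add: \<iota>_scale tensor_scale_left tensor_scale_right ugl_mat_alg.scale_right_distrib)
  show "\<iota> (gl_bracket X Y) \<otimes>\<^sub>U mat 1 + 1 \<otimes>\<^sub>U gl_bracket X Y
      = (\<iota> X \<otimes>\<^sub>U mat 1 + 1 \<otimes>\<^sub>U X) ** (\<iota> Y \<otimes>\<^sub>U mat 1 + 1 \<otimes>\<^sub>U Y)
      - (\<iota> Y \<otimes>\<^sub>U mat 1 + 1 \<otimes>\<^sub>U Y) ** (\<iota> X \<otimes>\<^sub>U mat 1 + 1 \<otimes>\<^sub>U X)"
    unfolding \<iota>_bracket
    by (simp add: gl_bracket_def tensor_diff_left tensor_diff_right matrix_add_ldistrib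
        mat_add_rdistrib tensor_mult)
qed

lemma \<psi>_lie_hom: "ugl_mat_alg.lie_hom (\<lambda>X. \<iota> X \<otimes>\<^sub>U mat 1 - 1 \<otimes>\<^sub>U transpose X)"
  unfolding ugl_mat_alg.lie_hom_def
proof (intro conjI allI)
  fix X Y :: "'a gl" and c
  have t: "transpose (X + Y) = transpose X + transpose Y"
    "transpose (gl_scale c X) = gl_scale c (transpose X)"
    by (simp_all add: transpose_def gl_scale_def vec_eq_iff)
  have b: "transpose (gl_bracket X Y) = transpose Y ** transpose X - transpose X ** transpose Y"
    unfolding gl_bracket_def matrix_transpose_mul[symmetric] by (simp add: transpose_def vec_eq_iff)
  show "\<iota> (X + Y) \<otimes>\<^sub>U mat 1 - 1 \<otimes>\<^sub>U transpose (X + Y)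
      = \<iota> X \<otimes>\<^sub>U mat 1 - 1 \<otimes>\<^sub>U transpose X + (\<iota> Y \<otimes>\<^sub>U mat 1 - 1 \<otimes>\<^sub>U transpose Y)"
    by (simp add: t \<iota>_add tensor_add_left tensor_add_right)
  show "\<iota> (gl_scale c X) \<otimes>\<^sub>U mat 1 - 1 \<otimes>\<^sub>U transpose (gl_scale c X)
      = ugl_mat_scale c (\<iota> X \<otimes>\<^sub>U mat 1 - 1 \<otimes>\<^sub>U transpose X)"
    by (simp add: t \<iota>_scale tensor_scale_left tensor_scale_right ugl_mat_alg.scale_right_diff_distrib)
  show "\<iota> (gl_bracket X Y) \<otimes>\<^sub>U mat 1 - 1 \<otimes>\<^sub>U transpose (gl_bracket X Y)
      = (\<iota> X \<otimes>\<^sub>U mat 1 - 1 \<otimes>\<^sub>U transpose X) ** (\<iota> Y \<otimes>\<^sub>U mat 1 - 1 \<otimes>\<^sub>U transpose Y)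
      - (\<iota> Y \<otimes>\<^sub>U mat 1 - 1 \<otimes>\<^sub>U transpose Y) ** (\<iota> X \<otimes>\<^sub>U mat 1 - 1 \<otimes>\<^sub>U transpose X)"
    unfolding \<iota>_bracket b
    by (simp add: tensor_diff_left tensor_diff_right mat_diff_ldistrib mat_diff_rdistrib tensor_mult)
qed

lemma \<phi>_hom: "ugl_mat_hom \<phi>" and \<phi>_\<iota>: "\<phi> (\<iota> X) = \<iota> X \<otimes>\<^sub>U mat 1 + 1 \<otimes>\<^sub>U X"
  unfolding \<phi>_def using ugl_extend[OF \<phi>_lie_hom] by blast+

lemma \<psi>_hom: "ugl_mat_hom \<psi>" and \<psi>_\<iota>: "\<psi> (\<iota> X) = \<iota> X \<otimes>\<^sub>U mat 1 - 1 \<otimes>\<^sub>U transpose X"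
  unfolding \<psi>_def using ugl_extend[OF \<psi>_lie_hom] by blast+


section \<open>The action of \<open>gl\<^sub>2\<^sub>n\<close>\<close>

definition F\<^sub>1 :: "('n::finite) ugl_mat"
  where "F\<^sub>1 = (\<Sum>i\<in>UNIV. \<Sum>j\<in>UNIV. \<iota> (mat_unit j i) \<otimes>\<^sub>U mat_unit i j)"

definition F\<^sub>2 :: "('n::finite) ugl_mat"
  where "F\<^sub>2 = (\<Sum>i\<in>UNIV. \<Sum>j\<in>UNIV. \<Sum>r\<in>UNIV.
    (\<iota> (mat_unit i r) * \<iota> (mat_unit r j)) \<otimes>\<^sub>U mat_unit j i)"

lemma trace_sum: "trace (\<Sum>i\<in>S. f i) = (\<Sum>i\<in>S. trace (f i :: ('n::finite) ugl_mat))"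
  by (simp add: trace_def sum_component) (rule sum.swap)

lemma trace_mat_unit: "trace (mat_unit i j) = (if i = j then 1 else 0)"
  by (simp add: trace_def mat_unit_def if_distrib if_distribR sum.delta cong: conj_cong)

lemma trace_F\<^sub>1: "trace F\<^sub>1 = (\<Sum>i\<in>UNIV. \<iota> (mat_unit i i))"
proof -
  have "ugl_scale (if i = j then 1 else 0) a = (if j = i then a else 0)" for i j :: 'a and a :: "'a ugl"
    by simp
  then show ?thesis
    by (simp add: F\<^sub>1_def trace_sum trace_tensor trace_mat_unit)
qed

lemma mat_unit_mult: "mat_unit i j ** mat_unit k l = (if j = k then mat_unit i l else 0)"
proof -
  have "(\<Sum>m\<in>UNIV. (if x = i \<and> m = j then 1 else 0) * (if m = k \<and> y = l then 1 else 0 :: complex))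
      = (\<Sum>m\<in>UNIV. if m = j then (if x = i \<and> j = k \<and> y = l then 1 else 0) else 0)" for x y
    by (rule sum.cong) auto
  then show ?thesis
    by (simp add: mat_unit_def matrix_matrix_mult_def vec_eq_iff)
qed

lemma trace_unit_F\<^sub>2:
  "trace ((1 \<otimes>\<^sub>U mat_unit i j) ** F\<^sub>2) = (\<Sum>r\<in>UNIV. \<iota> (mat_unit i r) * \<iota> (mat_unit r j))"
proof -
  have mult_sum: "M ** (\<Sum>k\<in>S. f k) = (\<Sum>k\<in>S. M ** f k)" if "finite S"
    for M :: "'a ugl_mat" and f :: "'a \<Rightarrow> 'a ugl_mat" and S
    using that by induction (simp_all add: ugl_mat_alg.mul_zero_right matrix_add_ldistrib)
  have sum_if: "(\<Sum>r\<in>UNIV. if P then g r else 0) = (if P then \<Sum>r\<in>UNIV. g r else 0)"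
    for P and g :: "'a \<Rightarrow> 'a ugl"
    by simp
  have *: "trace ((1 \<otimes>\<^sub>U mat_unit i j) ** (a \<otimes>\<^sub>U mat_unit l k))
      = (if k = i then if l = j then a else 0 else 0)" for k l and a :: "'a ugl"
  proof -
    have "trace (0 :: 'a gl) = 0" by (simp add: trace_def)
    then show ?thesis by (auto simp: tensor_mult trace_tensor mat_unit_mult trace_mat_unit)
  qed
  have "trace ((1 \<otimes>\<^sub>U mat_unit i j) ** F\<^sub>2)
      = (\<Sum>k\<in>UNIV. \<Sum>l\<in>UNIV. \<Sum>r\<in>UNIV.
          if k = i then if l = j then \<iota> (mat_unit k r) * \<iota> (mat_unit r l) else 0 else 0)"
    unfolding F\<^sub>2_def by (simp only: mult_sum[OF finite] trace_sum *)
  also have "\<dots> = (\<Sum>k\<in>UNIV. if k = i then \<Sum>l\<in>UNIV. if l = j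
          then \<Sum>r\<in>UNIV. \<iota> (mat_unit k r) * \<iota> (mat_unit r l) else 0 else 0)"
    by (simp only: sum_if)
  finally show ?thesis by simp
qed

text \<open>
  Matrices of size \<open>2n\<close> are indexed by \<open>'n + 'n\<close>; \<open>Inl\<close> is the first block of indices.
\<close>

definition block_A :: "('n::finite + 'n) gl \<Rightarrow> 'n gl"
  where "block_A M = (\<chi> i j. M $ Inl i $ Inl j)"

definition block_B :: "('n::finite + 'n) gl \<Rightarrow> 'n gl"
  where "block_B M = (\<chi> i j. M $ Inl i $ Inr j)"

definition block_C :: "('n::finite + 'n) gl \<Rightarrow> 'n gl"
  where "block_C M = (\<chi> i j. M $ Inr i $ Inl j)"

definition block_D :: "('n::finite + 'n) gl \<Rightarrow> 'n gl"
  where "block_D M = (\<chi> i j. M $ Inr i $ Inr j)"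

definition inv_transpose :: "('n::finite) gl \<Rightarrow> 'n gl"
  where "inv_transpose Q = transpose (matrix_inv Q)"

definition gl2n_action :: "('n::finite) gl \<Rightarrow> ('n + 'n) gl \<Rightarrow> 'n ugl \<Rightarrow> 'n ugl"
  where "gl2n_action Q M a =
    \<iota> (block_A M) * a
    - a * \<iota> (inv_transpose Q ** block_D M ** transpose Q)
    + trace (\<psi> a ** (1 \<otimes>\<^sub>U Q) ** (1 \<otimes>\<^sub>U transpose (block_B M)))
    - trace (\<phi> a ** F\<^sub>2 ** (1 \<otimes>\<^sub>U inv_transpose Q) ** (1 \<otimes>\<^sub>U block_C M))
    - trace (\<phi> a ** (1 \<otimes>\<^sub>U inv_transpose Q) ** (1 \<otimes>\<^sub>U block_C M)) * trace F\<^sub>1"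

end

theory Submission
  imports Defs
begin

text \<open>
  Write \<open>F = F\<^sub>1\<close> and \<open>P = Q\<^sup>-\<^sup>T\<close>. Conjugation by the block matrix \<open>diag(I, P)\<close>, a Lie algebra automorphism
  of \<open>gl\<^sub>2\<^sub>n\<close>, sends the blocks \<open>A, B, C, D\<close> to \<open>A, B Q\<^sup>T, P C, P D Q\<^sup>T\<close>; these are the combinations
  in which the blocks enter the action, so one may take \<open>Q = I\<close>. Moreover, the two terms with \<open>C\<close>
  combine: with \<open>G = F\<^sub>2 + tr(F) I\<close> their sum is \<open>- tr(\<phi>(a).G.C)\<close>, and reordering the products of
  matrix units in \<open>F\<^sub>2\<close> gives \<open>G = F.(F + n I)\<close> (\<open>G_eq\<close>). Hence \<open>A\<close> acts by left and \<open>D\<close> by minus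
  right multiplication, and, up to sign in the second case, \<open>B\<close> and \<open>C\<close> act by the operators
  \<open>\<beta>\<^sub>B(a) = tr(\<psi>(a).B\<^sup>T)\<close> and \<open>\<gamma>\<^sub>C(a) = tr(\<phi>(a).G.C)\<close>.

  Since \<open>\<psi>\<close> and \<open>\<phi>\<close> are multiplicative, and numerical matrices may be moved cyclically under the
  trace, one has \<open>\<beta>\<^sub>B(X a) = X \<beta>\<^sub>B(a) - \<beta>\<^sub>X\<^sub>B(a)\<close> and \<open>\<gamma>\<^sub>C(X a) = X \<gamma>\<^sub>C(a) + \<gamma>\<^sub>C\<^sub>X(a)\<close> for \<open>X\<close> in \<open>gl\<^sub>n\<close>.
  These are the commutation relations with the upper left block. As \<open>U(gl\<^sub>n)\<close> is generated from \<open>1\<close>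
  by left multiplications, they propagate any other commutation relation from \<open>1\<close> to all of
  \<open>U(gl\<^sub>n)\<close>. At \<open>1\<close> one has \<open>\<beta>\<^sub>B(1) = tr(B)\<close> and \<open>\<gamma>\<^sub>C(1) = tr(G.C)\<close>, and by bilinearity the blocks
  may be taken to be matrix units, so that only identities between the entries of \<open>F\<close> and \<open>G\<close> in
  \<open>U(gl\<^sub>n)\<close> remain.

  The relations of \<open>\<beta>\<close> with right multiplications and with itself are immediate at \<open>1\<close>. The relation
  between \<open>\<beta>\<close> and \<open>\<gamma>\<close> (\<open>trace_\<phi>_trace_\<psi>\<close>) follows by evaluating \<open>\<beta>\<close> on the entries of \<open>G\<close>, which
  are quadratic. The relations of \<open>\<gamma>\<close> with right multiplications (\<open>trace_\<phi>_mult_right\<close>) and with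
  itself (\<open>trace_\<phi>_commute\<close>) rest on one property: the entries of \<open>F\<close>, hence also those of every
  polynomial in \<open>F\<close>, transform under commutators with \<open>e\<^sub>k\<^sub>l\<close> like matrix units (\<open>invariant_mult\<close>).
  The first of these two is that property of \<open>G\<close> itself; for the second, it yields the commutator of
  two entries of \<open>G\<close> (\<open>G_commutator\<close>).
\<close>


section \<open>Scalar matrices and traces\<close>

lemma gl_scale_mult_left: "gl_scale c X ** Y = gl_scale c (X ** Y)"
  by (simp add: gl_scale_def matrix_matrix_mult_def vec_eq_iff sum_distrib_left mult.assoc)

lemma gl_scale_mult_right: "X ** gl_scale c Y = gl_scale c (X ** Y)"
  by (simp add: gl_scale_def matrix_matrix_mult_def vec_eq_iff sum_distrib_left mult.left_commute)

lemma gl_add_mult: "((X::('n::finite) gl) + Y) ** Z = X ** Z + Y ** Z"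
  by (simp add: matrix_matrix_mult_def vec_eq_iff distrib_right sum.distrib)

lemma gl_unit_induct [case_names unit add]:
  fixes X :: "('n::finite) gl"
  assumes unit: "\<And>c i j. P (gl_scale c (mat_unit i j))"
    and add: "\<And>X Y. P X \<Longrightarrow> P Y \<Longrightarrow> P (X + Y)"
  shows "P X"
proof -
  have "gl_scale 0 (mat_unit i j) = 0" for i j :: 'n
    by (simp add: gl_scale_def vec_eq_iff)
  then have P0: "P 0" using unit[of 0] by metis
  have P_sum: "P (\<Sum>i\<in>S. f i)" if "finite S" "\<And>i. P (f i)" for S :: "'n set" and f
    using that by (induction S rule: finite_induct) (auto intro: add P0)
  have "P (\<Sum>i\<in>UNIV. \<Sum>j\<in>UNIV. gl_scale (X $ i $ j) (mat_unit i j))"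
    by (intro P_sum unit finite)
  also have "(\<Sum>i\<in>UNIV. \<Sum>j\<in>UNIV. gl_scale (X $ i $ j) (mat_unit i j)) = X"
  proof -
    have "X $ i $ j * (if k = i \<and> l = j then 1 else 0) =
      (if l = j then if k = i then X $ i $ j else 0 else 0)" for i j k l
      by simp
    then show ?thesis
      by (simp add: vec_eq_iff gl_scale_def mat_unit_def)
  qed
  finally show ?thesis .
qed

lemma transpose_linear:
  "transpose (X + Y) = transpose X + transpose (Y :: ('n::finite) gl)"
  "transpose (gl_scale c X) = gl_scale c (transpose X)"
  by (simp_all add: transpose_def gl_scale_def vec_eq_iff)

lemma trace_scalar_left: "trace ((a \<otimes>\<^sub>U mat 1) ** M) = a * trace M"
proof -
  have "ugl_scale (if x = k then 1 else 0) a * M $ k $ x = (if x = k then a * M $ x $ x else 0)" for k x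
    by simp
  then show ?thesis
    by (simp add: trace_def tensor_def matrix_matrix_mult_def mat_def sum_distrib_left)
qed

text \<open>
  Cyclicity fails for the trace of matrices over the noncommutative ring \<open>U(gl\<^sub>n)\<close>, but holds when
  one of the factors has scalar entries.
\<close>

lemma trace_numeric_cyclic:
  "trace ((1 \<otimes>\<^sub>U Y) ** M ** (1 \<otimes>\<^sub>U X)) = trace (M ** (1 \<otimes>\<^sub>U (X ** Y)))"
proof -
  have c: "trace ((1 \<otimes>\<^sub>U Y) ** N) = trace (N ** (1 \<otimes>\<^sub>U Y))" for N
    unfolding trace_def tensor_def matrix_matrix_mult_def
    by (simp add: ugl_alg.mul_scl_left ugl_alg.mul_scl_right) (rule sum.swap)
  have "trace ((1 \<otimes>\<^sub>U Y) ** M ** (1 \<otimes>\<^sub>U X)) = trace ((1 \<otimes>\<^sub>U Y) ** (M ** (1 \<otimes>\<^sub>U X)))"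
    by (simp add: matrix_mul_assoc)
  also have "\<dots> = trace (M ** (1 \<otimes>\<^sub>U X) ** (1 \<otimes>\<^sub>U Y))" by (rule c)
  finally show ?thesis by (simp add: matrix_mul_assoc[symmetric] tensor_mult)
qed

lemma trace_mult_unit: "trace (M ** (1 \<otimes>\<^sub>U mat_unit i j)) = M $ j $ i"
proof -
  have "M $ k $ l * ugl_scale (if l = i \<and> k = j then 1 else 0) 1 =
     (if l = i then if k = j then M $ k $ l else 0 else 0)" for k l
    by simp
  then show ?thesis
    by (simp add: trace_def tensor_def matrix_matrix_mult_def mat_unit_def)
qed

lemma trace_ugl_simps:
  "trace (M + N) = trace M + trace (N :: ('n::finite) ugl_mat)"
  "trace (M - N) = trace M - trace (N :: ('n::finite) ugl_mat)"
  "trace (ugl_mat_scale c M) = ugl_scale c (trace M)"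
  by (simp_all add: trace_def ugl_mat_scale_def sum.distrib sum_subtractf ugl_alg.scale_sum_right)


section \<open>The operators of the off-diagonal blocks\<close>

definition trace_\<psi> :: "('n::finite) gl \<Rightarrow> 'n ugl \<Rightarrow> 'n ugl"
  where "trace_\<psi> B a = trace (\<psi> a ** (1 \<otimes>\<^sub>U transpose B))"

text \<open>
  The matrix \<open>F\<^sub>2 + tr(F\<^sub>1) I\<close>, by \<open>G_eq\<close>; as a polynomial in \<open>F\<^sub>1\<close> it visibly commutes with \<open>F\<^sub>1\<close> and
  inherits its invariance.
\<close>

definition G :: "('n::finite) ugl_mat"
  where "G = F\<^sub>1 ** (F\<^sub>1 + mat (of_nat CARD('n)))"

definition trace_\<phi> :: "('n::finite) gl \<Rightarrow> 'n ugl \<Rightarrow> 'n ugl"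
  where "trace_\<phi> C a = trace (\<phi> a ** G ** (1 \<otimes>\<^sub>U C))"

lemmas \<psi>_simps = \<psi>_hom[unfolded ugl_mat_hom_def]
lemmas \<phi>_simps = \<phi>_hom[unfolded ugl_mat_hom_def]

lemma trace_\<psi>_linear:
  "trace_\<psi> (B + B') a = trace_\<psi> B a + trace_\<psi> B' a"
  "trace_\<psi> (gl_scale c B) a = ugl_scale c (trace_\<psi> B a)"
  "trace_\<psi> B (a + b) = trace_\<psi> B a + trace_\<psi> B b"
  "trace_\<psi> B (ugl_scale c a) = ugl_scale c (trace_\<psi> B a)"
  by (simp_all add: trace_\<psi>_def \<psi>_simps transpose_linear tensor_add_right tensor_scale_right matrix_add_ldistrib
      mat_add_rdistrib trace_ugl_simps ugl_mat_alg.mul_scl_left ugl_mat_alg.mul_scl_right)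

lemma trace_\<phi>_linear:
  "trace_\<phi> (C + C') a = trace_\<phi> C a + trace_\<phi> C' a"
  "trace_\<phi> (gl_scale c C) a = ugl_scale c (trace_\<phi> C a)"
  "trace_\<phi> C (a + b) = trace_\<phi> C a + trace_\<phi> C b"
  "trace_\<phi> C (ugl_scale c a) = ugl_scale c (trace_\<phi> C a)"
  by (simp_all add: trace_\<phi>_def \<phi>_simps tensor_add_right tensor_scale_right matrix_add_ldistrib
      mat_add_rdistrib trace_ugl_simps ugl_mat_alg.mul_scl_left ugl_mat_alg.mul_scl_right)

lemma trace_\<psi>_zero: "trace_\<psi> 0 a = 0" "trace_\<psi> B 0 = 0"
  using trace_\<psi>_linear(1)[of 0 0 a] trace_\<psi>_linear(3)[of B 0 0] by simp_all

lemma trace_\<phi>_zero: "trace_\<phi> 0 a = 0" "trace_\<phi> C 0 = 0"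
  using trace_\<phi>_linear(1)[of 0 0 a] trace_\<phi>_linear(3)[of C 0 0] by simp_all

lemma trace_\<psi>_diff: "trace_\<psi> (B - B') a = trace_\<psi> B a - trace_\<psi> B' a" "trace_\<psi> B (a - b) = trace_\<psi> B a - trace_\<psi> B b"
  using trace_\<psi>_linear(1)[of "B - B'" B' a] trace_\<psi>_linear(3)[of B "a - b" b] by (simp_all add: eq_diff_eq)

lemma trace_\<phi>_diff: "trace_\<phi> (C - C') a = trace_\<phi> C a - trace_\<phi> C' a" "trace_\<phi> C (a - b) = trace_\<phi> C a - trace_\<phi> C b"
  using trace_\<phi>_linear(1)[of "C - C'" C' a] trace_\<phi>_linear(3)[of C "a - b" b] by (simp_all add: eq_diff_eq)

lemma trace_\<psi>_sum: "finite S \<Longrightarrow> trace_\<psi> B (\<Sum>x\<in>S. f x) = (\<Sum>x\<in>S. trace_\<psi> B (f x))"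
  by (induction S rule: finite_induct) (simp_all add: trace_\<psi>_zero trace_\<psi>_linear)

lemma trace_\<phi>_sum: "finite S \<Longrightarrow> trace_\<phi> C (\<Sum>x\<in>S. f x) = (\<Sum>x\<in>S. trace_\<phi> C (f x))"
  by (induction S rule: finite_induct) (simp_all add: trace_\<phi>_zero trace_\<phi>_linear)

lemma trace_\<psi>_one: "trace_\<psi> B 1 = ugl_scale (trace B) 1"
proof -
  have "trace_\<psi> B 1 = trace (1 \<otimes>\<^sub>U transpose B)"
    by (simp add: trace_\<psi>_def \<psi>_simps)
  then show ?thesis by (simp add: trace_tensor) (simp add: trace_def transpose_def)
qed

lemma trace_\<phi>_one: "trace_\<phi> C 1 = trace (G ** (1 \<otimes>\<^sub>U C))"
  by (simp add: trace_\<phi>_def \<phi>_simps)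

text \<open>
  The commutation relations with left multiplications: multiplicativity splits off the first
  factor \<open>\<psi>(X) = X \<otimes> I - 1 \<otimes> X\<^sup>T\<close> or \<open>\<phi>(X) = X \<otimes> I + 1 \<otimes> X\<close>, and its numerical part moves around
  the trace and is absorbed into the block.
\<close>

lemma trace_\<psi>_gen: "trace_\<psi> B (\<iota> X * a) = \<iota> X * trace_\<psi> B a - trace_\<psi> (X ** B) a"
proof -
  have "\<psi> (\<iota> X * a) ** (1 \<otimes>\<^sub>U transpose B) =
    (\<iota> X \<otimes>\<^sub>U mat 1) ** (\<psi> a ** (1 \<otimes>\<^sub>U transpose B)) - (1 \<otimes>\<^sub>U transpose X) ** \<psi> a ** (1 \<otimes>\<^sub>U transpose B)"
    by (simp add: \<psi>_simps \<psi>_\<iota> mat_diff_rdistrib matrix_mul_assoc)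
  then show ?thesis
    by (simp add: trace_\<psi>_def trace_ugl_simps trace_scalar_left trace_numeric_cyclic matrix_transpose_mul)
qed

lemma trace_\<phi>_gen: "trace_\<phi> C (\<iota> X * a) = \<iota> X * trace_\<phi> C a + trace_\<phi> (C ** X) a"
proof -
  have "\<phi> (\<iota> X * a) ** G ** (1 \<otimes>\<^sub>U C) =
    (\<iota> X \<otimes>\<^sub>U mat 1) ** (\<phi> a ** G ** (1 \<otimes>\<^sub>U C)) + (1 \<otimes>\<^sub>U X) ** (\<phi> a ** G) ** (1 \<otimes>\<^sub>U C)"
    by (simp add: \<phi>_simps \<phi>_\<iota> mat_add_rdistrib matrix_mul_assoc)
  then show ?thesis
    by (simp add: trace_\<phi>_def trace_ugl_simps trace_scalar_left trace_numeric_cyclic)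
qed

lemma trace_\<phi>_unit_one: "trace_\<phi> (mat_unit i j) 1 = G $ j $ i"
  by (simp add: trace_\<phi>_one trace_mult_unit)

lemma F\<^sub>1_entry: "F\<^sub>1 $ i $ j = \<iota> (mat_unit j i)"
proof -
  have "ugl_scale (mat_unit k l $ i $ j) (\<iota> (mat_unit l k)) =
    (if l = j then if k = i then \<iota> (mat_unit l k) else 0 else 0)" for k l
    by (auto simp: mat_unit_def)
  then show ?thesis
    by (simp add: F\<^sub>1_def tensor_def)
qed


section \<open>Invariant matrices over the enveloping algebra\<close>

abbreviation e :: "'n \<Rightarrow> 'n \<Rightarrow> ('n::finite) ugl"
  where "e i j \<equiv> \<iota> (mat_unit i j)"

lemma \<iota>_zero: "\<iota> 0 = 0"
  using \<iota>_add[of 0 0] by simp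

lemma \<iota>_diff: "\<iota> (X - Y) = \<iota> X - \<iota> Y"
  using \<iota>_add[of "X - Y" Y] by (simp add: algebra_simps)

lemma \<iota>_unit_mult: "\<iota> (mat_unit i j ** mat_unit k l) = (if j = k then e i l else 0)"
  by (simp add: mat_unit_mult \<iota>_zero)

lemma e_commutator:
  "e i j * e k l - e k l * e i j = (if j = k then e i l else 0) - (if l = i then e k j else 0)"
  by (simp add: \<iota>_bracket[symmetric] gl_bracket_def \<iota>_diff \<iota>_unit_mult)

text \<open>
  Invariance under \<open>gl\<^sub>n\<close>, written for matrix units: \<open>M\<close> commutes with \<open>\<phi>(X)\<close> for all \<open>X\<close>. Entrywise,
  the entry of \<open>M\<close> at \<open>(i, j)\<close> has the same commutators with \<open>gl\<^sub>n\<close> as \<open>e\<^sub>j\<^sub>i\<close>.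
\<close>

definition invariant :: "('n::finite) ugl_mat \<Rightarrow> bool"
  where "invariant M \<longleftrightarrow> (\<forall>i j k l. M $ i $ j * e k l - e k l * M $ i $ j
    = (if k = i then M $ l $ j else 0) - (if l = j then M $ i $ k else 0))"

lemma invariantD:
  "invariant M \<Longrightarrow> M $ i $ j * e k l - e k l * M $ i $ j
    = (if k = i then M $ l $ j else 0) - (if l = j then M $ i $ k else 0)"
  by (simp add: invariant_def)

lemma invariant_F\<^sub>1: "invariant F\<^sub>1"
  by (simp add: invariant_def F\<^sub>1_entry e_commutator)

lemma invariant_add: "invariant M \<Longrightarrow> invariant N \<Longrightarrow> invariant (M + N)"
  unfolding invariant_def
proof (intro allI)
  fix i j k l
  assume "\<forall>i j k l. M $ i $ j * e k l - e k l * M $ i $ j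
      = (if k = i then M $ l $ j else 0) - (if l = j then M $ i $ k else 0)"
    and "\<forall>i j k l. N $ i $ j * e k l - e k l * N $ i $ j
      = (if k = i then N $ l $ j else 0) - (if l = j then N $ i $ k else 0)"
  then have "(M $ i $ j * e k l - e k l * M $ i $ j) + (N $ i $ j * e k l - e k l * N $ i $ j)
    = ((if k = i then M $ l $ j else 0) - (if l = j then M $ i $ k else 0))
      + ((if k = i then N $ l $ j else 0) - (if l = j then N $ i $ k else 0))"
    by (metis (no_types, lifting))
  then show "(M + N) $ i $ j * e k l - e k l * (M + N) $ i $ j
      = (if k = i then (M + N) $ l $ j else 0) - (if l = j then (M + N) $ i $ k else 0)"
    by (simp add: algebra_simps split: if_splits)
qed

lemma invariant_of_nat: "invariant (mat (of_nat m))"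
  by (auto simp: invariant_def mat_def mult_of_nat_commute)

text \<open>
  The commutator is a derivation, so it produces two terms from each factor; the two that act on the
  summation index cancel.
\<close>

lemma invariant_mult:
  assumes M: "invariant M" and N: "invariant N"
  shows "invariant (M ** N)"
  unfolding invariant_def
proof (intro allI)
  fix i j k l
  have "(M ** N) $ i $ j * e k l - e k l * (M ** N) $ i $ j
    = (\<Sum>r\<in>UNIV. M $ i $ r * (N $ r $ j * e k l - e k l * N $ r $ j)
        + (M $ i $ r * e k l - e k l * M $ i $ r) * N $ r $ j)"
    by (simp add: matrix_matrix_mult_def sum_distrib_left sum_distrib_right
        sum_subtractf[symmetric] algebra_simps)
  also have "\<dots> = (\<Sum>r\<in>UNIV. (if k = i then M $ l $ r * N $ r $ j else 0)
      - (if l = j then M $ i $ r * N $ r $ k else 0)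
      + (if r = k then M $ i $ k * N $ l $ j else 0) - (if r = l then M $ i $ k * N $ l $ j else 0))"
    using M N unfolding invariant_def by (intro sum.cong) (auto simp: left_diff_distrib right_diff_distrib)
  also have "\<dots> = (if k = i then (M ** N) $ l $ j else 0) - (if l = j then (M ** N) $ i $ k else 0)"
    by (simp add: sum.distrib sum_subtractf matrix_matrix_mult_def)
  finally show "(M ** N) $ i $ j * e k l - e k l * (M ** N) $ i $ j
    = (if k = i then (M ** N) $ l $ j else 0) - (if l = j then (M ** N) $ i $ k else 0)" .
qed

lemma invariant_G: "invariant G"
  unfolding G_def by (intro invariant_mult invariant_add invariant_F\<^sub>1 invariant_of_nat)

lemma mat_of_nat_mult: "(mat (of_nat m) ** (M :: ('n::finite) ugl_mat)) $ i $ j = of_nat m * M $ i $ j"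
  "(M ** mat (of_nat m)) $ i $ j = of_nat m * M $ i $ j"
  by (simp_all add: matrix_matrix_mult_def mat_def if_distrib if_distribR mult_of_nat_commute cong: if_cong)

lemma F\<^sub>1_G_commute: "F\<^sub>1 ** G = G ** F\<^sub>1"
proof -
  have "mat (of_nat m) ** M = M ** mat (of_nat m)" for m and M :: "'a ugl_mat"
    by (simp add: vec_eq_iff mat_of_nat_mult)
  then show ?thesis
    by (simp add: G_def matrix_add_ldistrib mat_add_rdistrib matrix_mul_assoc)
      (metis matrix_mul_assoc)
qed

lemma G_entry_product: "(G :: ('n::finite) ugl_mat) $ i $ j = (\<Sum>r\<in>UNIV. F\<^sub>1 $ i $ r * F\<^sub>1 $ r $ j)
   + of_nat CARD('n) * F\<^sub>1 $ i $ j"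
  by (simp add: G_def matrix_add_ldistrib mat_of_nat_mult) (simp add: matrix_matrix_mult_def)

text \<open>
  Compared with \<open>F\<^sub>1 ** F\<^sub>1\<close>, the products of matrix units in \<open>F\<^sub>2\<close> have their factors interchanged. The
  commutators that this costs sum to \<open>tr(F\<^sub>1) I - n F\<^sub>1\<close>, which is why adding \<open>n F\<^sub>1\<close> leaves exactly
  \<open>F\<^sub>2 + tr(F\<^sub>1) I\<close>.
\<close>

lemma G_entry: "(G :: ('n::finite) ugl_mat) $ i $ j
  = (\<Sum>r\<in>UNIV. e j r * e r i) + (if i = j then trace F\<^sub>1 else 0)"
proof -
  have "e r i * e j r = e j r * e r i + (if i = j then e r r else 0) - e j i" for r
    using e_commutator[of r i j r] by (simp add: algebra_simps)
  then have "(G :: 'n ugl_mat) $ i $ j = (\<Sum>r\<in>UNIV. e j r * e r i + (if i = j then e r r else 0) - e j i)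
    + of_nat CARD('n) * e j i"
    by (simp add: G_entry_product F\<^sub>1_entry)
  then show ?thesis
    by (simp add: sum.distrib sum_subtractf trace_F\<^sub>1)
qed

lemma F\<^sub>2_entry: "F\<^sub>2 $ i $ j = (\<Sum>r\<in>UNIV. e j r * e r i)"
proof -
  have "trace ((1 \<otimes>\<^sub>U mat_unit j i) ** F\<^sub>2) = F\<^sub>2 $ i $ j"
    using trace_numeric_cyclic[of "mat_unit j i" F\<^sub>2 "mat 1"]
    by (simp add: tensor_one_mat trace_mult_unit)
  then show ?thesis by (simp add: trace_unit_F\<^sub>2)
qed

lemma G_eq: "G = F\<^sub>2 + mat (trace F\<^sub>1)"
  by (simp add: vec_eq_iff G_entry F\<^sub>2_entry mat_def)


section \<open>Commutation relations\<close>

lemma trace_\<psi>_unit_mult: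
  "trace_\<psi> (mat_unit i j ** mat_unit k l) a = (if j = k then trace_\<psi> (mat_unit i l) a else 0)"
  by (simp add: mat_unit_mult trace_\<psi>_zero)

lemma trace_\<phi>_unit_mult:
  "trace_\<phi> (mat_unit i j ** mat_unit k l) a = (if j = k then trace_\<phi> (mat_unit i l) a else 0)"
  by (simp add: mat_unit_mult trace_\<phi>_zero)

text \<open>
  The commutation relations with right multiplications. Left factors of \<open>a\<close> enter both sides by
  the same recursion, so the relations reduce to \<open>a = 1\<close>, where the first is \<open>tr(B D) = tr(D B)\<close> and the second
  is the invariance of \<open>G\<close>.
\<close>

lemma trace_\<psi>_mult_right: "trace_\<psi> B (a * \<iota> D) = trace_\<psi> B a * \<iota> D - trace_\<psi> (B ** D) a"
proof (induction a arbitrary: B rule: ugl_induct)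
  case (const c)
  have "trace_\<psi> B (\<iota> D) = trace_\<psi> B 1 * \<iota> D - trace_\<psi> (B ** D) 1"
    using trace_\<psi>_gen[of B D 1] trace_mul_sym[of B D]
    by (simp add: trace_\<psi>_one ugl_alg.mul_scl_left ugl_alg.mul_scl_right)
  then show ?case
    by (simp add: ugl_alg.mul_scl_left trace_\<psi>_linear ugl_alg.scale_right_diff_distrib)
next
  case (gen X a)
  then show ?case
    by (simp add: mult.assoc trace_\<psi>_gen matrix_mul_assoc left_diff_distrib right_diff_distrib)
next
  case (add a b)
  then show ?case by (simp add: distrib_right trace_\<psi>_linear)
qed

lemma trace_\<phi>_mult_right: "trace_\<phi> C (a * \<iota> D) = trace_\<phi> C a * \<iota> D + trace_\<phi> (D ** C) a"
proof (induction a arbitrary: C rule: ugl_induct)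
  case (const c)
  have "trace_\<phi> C 1 * \<iota> D - \<iota> D * trace_\<phi> C 1 = trace_\<phi> (C ** D) 1 - trace_\<phi> (D ** C) 1"
  proof (induction C rule: gl_unit_induct)
    case C: (unit c i j)
    show ?case
    proof (induction D rule: gl_unit_induct)
      case (unit d k l)
      have "G $ j $ i * e k l - e k l * G $ j $ i
          = (if k = j then G $ l $ i else 0) - (if l = i then G $ j $ k else 0)"
        by (rule invariantD[OF invariant_G])
      then show ?case
        by (simp add: \<iota>_scale ugl_alg.mul_scl_left ugl_alg.mul_scl_right trace_\<phi>_linear
            gl_scale_mult_left gl_scale_mult_right trace_\<phi>_unit_mult trace_\<phi>_unit_one mult.commute
            ugl_alg.scale_right_diff_distrib[symmetric])
    qed (simp add: \<iota>_add matrix_add_ldistrib gl_add_mult trace_\<phi>_linear algebra_simps)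
  qed (simp add: matrix_add_ldistrib gl_add_mult trace_\<phi>_linear algebra_simps)
  then have "trace_\<phi> C (\<iota> D) = trace_\<phi> C 1 * \<iota> D + trace_\<phi> (D ** C) 1"
    using trace_\<phi>_gen[of C D 1] by (simp add: algebra_simps)
  then show ?case
    by (simp add: ugl_alg.mul_scl_left trace_\<phi>_linear ugl_alg.scale_right_distrib)
next
  case (gen X a)
  then show ?case
    by (simp add: mult.assoc trace_\<phi>_gen matrix_mul_assoc distrib_left distrib_right)
next
  case (add a b)
  then show ?case by (simp add: distrib_right trace_\<phi>_linear)
qed

lemma trace_\<psi>_commute: "trace_\<psi> B (trace_\<psi> B' a) = trace_\<psi> B' (trace_\<psi> B a)"
proof (induction a arbitrary: B B' rule: ugl_induct)
  case (const c)
  show ?case by (simp add: trace_\<psi>_linear trace_\<psi>_one ugl_alg.scale_left_commute)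
next
  case (gen X a)
  then show ?case
    by (simp add: trace_\<psi>_gen trace_\<psi>_diff)
next
  case (add a b)
  then show ?case by (simp add: trace_\<psi>_linear)
qed

lemma trace_\<psi>_\<iota>: "trace_\<psi> B (\<iota> X) = \<iota> X * trace_\<psi> B 1 - trace_\<psi> (X ** B) 1"
  using trace_\<psi>_gen[of B X 1] by simp

lemma trace_\<phi>_\<iota>: "trace_\<phi> C (\<iota> X) = \<iota> X * trace_\<phi> C 1 + trace_\<phi> (C ** X) 1"
  using trace_\<phi>_gen[of C X 1] by simp

text \<open>
  The entries of \<open>G\<close> are quadratic, so that evaluating the operators on them takes the recursion twice.
\<close>

lemma trace_\<psi>_product:
  "trace_\<psi> B (\<iota> X * \<iota> Y) = \<iota> X * \<iota> Y * trace_\<psi> B 1 - \<iota> X * trace_\<psi> (Y ** B) 1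
    - \<iota> Y * trace_\<psi> (X ** B) 1 + trace_\<psi> (Y ** X ** B) 1"
  by (simp add: trace_\<psi>_gen trace_\<psi>_\<iota> matrix_mul_assoc mult.assoc right_diff_distrib)

lemma trace_\<phi>_product:
  "trace_\<phi> C (\<iota> X * \<iota> Y) = \<iota> X * \<iota> Y * trace_\<phi> C 1 + \<iota> X * trace_\<phi> (C ** Y) 1
    + \<iota> Y * trace_\<phi> (C ** X) 1 + trace_\<phi> (C ** X ** Y) 1"
  by (simp add: trace_\<phi>_gen trace_\<phi>_\<iota> matrix_mul_assoc mult.assoc distrib_left)

lemma trace_\<psi>_unit_one: "trace_\<psi> (mat_unit i j) 1 = (if i = j then 1 else 0)"
  by (simp add: trace_\<psi>_one trace_mat_unit)

lemma trace_\<psi>_G: "trace_\<psi> (mat_unit a b) (G $ d $ c)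
  = (if a = b then G $ d $ c else 0) - (if d = a then e c b else 0) - (if b = c then e a d else 0)"
proof -
  have quad: "trace_\<psi> (mat_unit a b) (e c r * e r d) = (if a = b then e c r * e r d else 0)
      - (if r = b then if d = a then e c b else 0 else 0)
      - (if r = a then if b = c then e a d else 0 else 0)
      + (if r = a then if d = c \<and> a = b then 1 else 0 else 0)" for r a b c d :: 'a
    by (simp add: trace_\<psi>_product trace_\<psi>_unit_mult trace_\<psi>_unit_one mat_unit_mult trace_\<psi>_zero matrix_mul_assoc[symmetric])
  have lin: "trace_\<psi> (mat_unit a b) (e r r) = (if a = b then e r r else 0) - (if r = a then if a = b then 1 else 0 else 0)" for r a b :: 'a
    by (simp add: trace_\<psi>_\<iota> trace_\<psi>_unit_mult trace_\<psi>_unit_one)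
  show ?thesis
    by (simp add: G_entry trace_F\<^sub>1 trace_\<psi>_linear trace_\<psi>_sum trace_\<psi>_zero quad lin sum.distrib sum_subtractf
       if_distrib[of "trace_\<psi> _"])
qed

lemma trace_\<phi>_G: "trace_\<phi> (mat_unit a b) ((G :: ('n::finite) ugl_mat) $ d $ c)
  = G $ d $ c * G $ b $ a + e c b * G $ d $ a
    + (if b = c then (F\<^sub>1 ** G) $ d $ a + of_nat CARD('n) * G $ d $ a else 0)
    + (if c = d then G $ b $ a else 0)"
proof -
  have quad: "trace_\<phi> (mat_unit a b) (e c r * e r d) = e c r * e r d * G $ b $ a
      + (if r = b then e c b * G $ d $ a else 0)
      + (if b = c then F\<^sub>1 $ d $ r * G $ r $ a else 0)
      + (if b = c then G $ d $ a else 0)" for r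
    by (cases "b = c") (simp_all add: trace_\<phi>_product trace_\<phi>_unit_mult trace_\<phi>_unit_one F\<^sub>1_entry mat_unit_mult
        trace_\<phi>_zero)
  have lin: "trace_\<phi> (mat_unit a b) (e r r) = e r r * G $ b $ a + (if r = b then G $ b $ a else 0)" for r
    by (simp add: trace_\<phi>_\<iota> trace_\<phi>_unit_mult trace_\<phi>_unit_one)
  have "trace_\<phi> (mat_unit a b) (G $ d $ c) = (\<Sum>r\<in>UNIV. trace_\<phi> (mat_unit a b) (e c r * e r d))
     + (if d = c then \<Sum>r\<in>UNIV. trace_\<phi> (mat_unit a b) (e r r) else 0)"
    by (simp add: G_entry[of d c] trace_F\<^sub>1 trace_\<phi>_linear trace_\<phi>_sum trace_\<phi>_zero)
  also have "\<dots> = G $ d $ c * G $ b $ a + e c b * G $ d $ a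
    + (if b = c then (F\<^sub>1 ** G) $ d $ a + of_nat CARD('n) * G $ d $ a else 0)
    + (if c = d then G $ b $ a else 0)"
    by (simp add: quad lin sum.distrib matrix_matrix_mult_def G_entry[of d c] trace_F\<^sub>1
       distrib_right sum_distrib_right)
  finally show ?thesis .
qed

text \<open>
  One factor \<open>G\<close> is expanded as \<open>F\<^sub>1 ** F\<^sub>1 + n F\<^sub>1\<close>; the commutator with the other one is a derivation,
  whose value on the entries of \<open>F\<^sub>1\<close> is given by the invariance of \<open>G\<close>. That \<open>F\<^sub>1\<close> and \<open>G\<close> commute
  makes the two cubic terms have the same shape.
\<close>

lemma G_commutator: "(G :: ('n::finite) ugl_mat) $ d $ c * G $ b $ a - G $ b $ a * G $ d $ c
  = G $ b $ c * e a d - e c b * G $ d $ a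
    + (if a = d then (F\<^sub>1 ** G) $ b $ c + of_nat CARD('n) * G $ b $ c else 0)
    - (if b = c then (F\<^sub>1 ** G) $ d $ a + of_nat CARD('n) * G $ d $ a else 0)"
proof -
  let ?g = "(G :: 'n ugl_mat) $ d $ c"
  note com = invariantD[OF invariant_G, of d c]
  have "?g * G $ b $ a - G $ b $ a * ?g
    = (\<Sum>r\<in>UNIV. (?g * e r b - e r b * ?g) * e a r + e r b * (?g * e a r - e a r * ?g))
      + of_nat CARD('n) * (?g * e a b - e a b * ?g)"
    by (simp add: G_entry_product[of b a] F\<^sub>1_entry distrib_left distrib_right left_diff_distrib right_diff_distrib
       sum_distrib_left sum_distrib_right sum_subtractf sum.distrib mult.assoc)
      (metis mult.assoc mult_of_nat_commute)
  also have "\<dots> = (\<Sum>r\<in>UNIV. (if r = d then G $ b $ c * e a d else 0)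
       - (if b = c then G $ d $ r * F\<^sub>1 $ r $ a else 0)
       + (if a = d then F\<^sub>1 $ b $ r * G $ r $ c else 0) - (if r = c then e c b * G $ d $ a else 0))
      + of_nat CARD('n) * ((if a = d then G $ b $ c else 0) - (if b = c then G $ d $ a else 0))"
    unfolding com by (intro arg_cong2[where f = "(+)"] sum.cong refl)
      (auto simp: F\<^sub>1_entry left_diff_distrib right_diff_distrib)
  also have "\<dots> = G $ b $ c * e a d - e c b * G $ d $ a
    + (if a = d then (F\<^sub>1 ** G) $ b $ c + of_nat CARD('n) * G $ b $ c else 0)
    - (if b = c then (G ** F\<^sub>1) $ d $ a + of_nat CARD('n) * G $ d $ a else 0)"
    by (simp add: sum.distrib sum_subtractf matrix_matrix_mult_def right_diff_distrib)
  finally show ?thesis unfolding F\<^sub>1_G_commute .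
qed

text \<open>
  This is the relation \<open>[B, C] = B C - C B\<close>: the first product lies in the upper left block, which acts
  from the left, the second one in the lower right block, which acts by minus right multiplication;
  \<open>C\<close> itself acts by minus \<open>trace_\<phi> C\<close>.
\<close>

lemma trace_\<phi>_trace_\<psi>: "trace_\<phi> C (trace_\<psi> B a) = trace_\<psi> B (trace_\<phi> C a) + \<iota> (B ** C) * a + a * \<iota> (C ** B)"
proof (induction a arbitrary: B C rule: ugl_induct)
  case (const c)
  have unit: "trace_\<phi> C (trace_\<psi> (mat_unit i j) 1)
    = trace_\<psi> (mat_unit i j) (trace_\<phi> C 1) + \<iota> (mat_unit i j ** C) + \<iota> (C ** mat_unit i j)" for i j and C :: "'a gl"
  proof (induction C rule: gl_unit_induct)
    case (unit d k l)
    have "trace_\<phi> (mat_unit k l) (trace_\<psi> (mat_unit i j) 1) = trace_\<psi> (mat_unit i j) (trace_\<phi> (mat_unit k l) 1)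
        + \<iota> (mat_unit i j ** mat_unit k l) + \<iota> (mat_unit k l ** mat_unit i j)"
      by (simp add: trace_\<psi>_unit_one trace_\<phi>_unit_one trace_\<psi>_G trace_\<phi>_zero \<iota>_unit_mult)
    then show ?case
      by (simp add: \<iota>_scale trace_\<phi>_linear trace_\<psi>_linear gl_scale_mult_left gl_scale_mult_right
          ugl_alg.scale_right_distrib)
  qed (simp add: \<iota>_add matrix_add_ldistrib gl_add_mult trace_\<phi>_linear trace_\<psi>_linear)
  have "trace_\<phi> C (trace_\<psi> B 1) = trace_\<psi> B (trace_\<phi> C 1) + \<iota> (B ** C) + \<iota> (C ** B)"
    by (induction B rule: gl_unit_induct)
      (simp_all add: unit \<iota>_add \<iota>_scale matrix_add_ldistrib gl_add_mult gl_scale_mult_left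
        gl_scale_mult_right trace_\<phi>_linear trace_\<psi>_linear ugl_alg.scale_right_distrib)
  then show ?case
    by (simp add: ugl_alg.mul_scl_left ugl_alg.mul_scl_right trace_\<phi>_linear trace_\<psi>_linear ugl_alg.scale_right_distrib)
next
  case (gen X a)
  have "\<iota> X * \<iota> (B ** C) - \<iota> (B ** C) * \<iota> X = \<iota> (X ** B ** C) - \<iota> (B ** C ** X)"
    by (simp add: \<iota>_bracket[symmetric] gl_bracket_def \<iota>_diff matrix_mul_assoc)
  then have "\<iota> (B ** C) * (\<iota> X * a) = \<iota> X * (\<iota> (B ** C) * a) - \<iota> (X ** B ** C) * a + \<iota> (B ** C ** X) * a"
    by (simp add: algebra_simps flip: mult.assoc distrib_right)
  with gen show ?case
    by (simp add: mult.assoc trace_\<psi>_gen trace_\<phi>_gen trace_\<psi>_linear trace_\<phi>_diff matrix_mul_assoc distrib_left)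
next
  case (add a b)
  then show ?case by (simp add: distrib_left distrib_right trace_\<psi>_linear trace_\<phi>_linear)
qed

text \<open>
  At \<open>a = 1\<close> and for matrix units, exchanging the blocks in \<open>trace_\<phi>_G\<close> changes its right-hand side by
  the commutator of two entries of \<open>G\<close> and by explicit terms. By \<open>G_commutator\<close> the cubic
  terms and those with the factor \<open>n\<close> cancel, and what remains is a commutator of an entry of \<open>G\<close> with
  a matrix unit, cancelled by the terms with Kronecker deltas on account of invariance.
\<close>

lemma trace_\<phi>_commute: "trace_\<phi> C (trace_\<phi> C' a) = trace_\<phi> C' (trace_\<phi> C a)"
proof (induction a arbitrary: C C' rule: ugl_induct)
  case (const c)
  have unit: "trace_\<phi> (mat_unit a b) (trace_\<phi> C' 1) = trace_\<phi> C' (trace_\<phi> (mat_unit a b) 1)" for a b and C' :: "'a gl"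
  proof (induction C' rule: gl_unit_induct)
    case (unit y c d)
    have "G $ b $ c * e a d - e a d * G $ b $ c
        = (if a = b then G $ d $ c else 0) - (if d = c then G $ b $ a else 0)"
      by (rule invariantD[OF invariant_G])
    then have "trace_\<phi> (mat_unit a b) (G $ d $ c) = trace_\<phi> (mat_unit c d) (G $ b $ a)"
      using G_commutator[of d c b a] by (auto simp: trace_\<phi>_G algebra_simps)
    then show ?case
      by (simp add: trace_\<phi>_linear trace_\<phi>_unit_one)
  qed (simp add: trace_\<phi>_linear)
  have "trace_\<phi> C (trace_\<phi> C' 1) = trace_\<phi> C' (trace_\<phi> C 1)"
    by (induction C rule: gl_unit_induct) (simp_all add: unit trace_\<phi>_linear)
  then show ?case by (simp add: trace_\<phi>_linear)
next
  case (gen X a)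
  then show ?case
    by (simp add: trace_\<phi>_gen trace_\<phi>_linear)
next
  case (add a b)
  then show ?case by (simp add: trace_\<phi>_linear)
qed


section \<open>The module structure\<close>

text \<open>The action of a block matrix for \<open>Q = I\<close>.\<close>

definition block_action :: "('n::finite) gl \<Rightarrow> 'n gl \<Rightarrow> 'n gl \<Rightarrow> 'n gl \<Rightarrow> 'n ugl \<Rightarrow> 'n ugl"
  where "block_action A B C D a = \<iota> A * a - a * \<iota> D + trace_\<psi> B a - trace_\<phi> C a"

lemma block_action_bracket:
  "block_action (A ** A' + B ** C' - (A' ** A + B' ** C)) (A ** B' + B ** D' - (A' ** B + B' ** D))
      (C ** A' + D ** C' - (C' ** A + D' ** C)) (C ** B' + D ** D' - (C' ** B + D' ** D)) a
    = block_action A B C D (block_action A' B' C' D' a)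
      - block_action A' B' C' D' (block_action A B C D a)"
proof -
  have "\<iota> (X ** Y) = \<iota> (Y ** X) + \<iota> X * \<iota> Y - \<iota> Y * \<iota> X" for X Y :: "'a gl"
    using \<iota>_bracket[of X Y] by (simp add: gl_bracket_def \<iota>_diff algebra_simps)
  note comm = this[of A A'] this[of D D']
  show ?thesis
    unfolding block_action_def
    by (simp add: \<iota>_add \<iota>_diff comm trace_\<psi>_linear(1,3) trace_\<phi>_linear(1,3) trace_\<psi>_diff trace_\<phi>_diff
        trace_\<psi>_gen trace_\<phi>_gen trace_\<psi>_mult_right trace_\<phi>_mult_right trace_\<phi>_trace_\<psi>
        trace_\<psi>_commute[of B B'] trace_\<phi>_commute[of C C'] algebra_simps)
qed

lemma sum_UNIV_Plus:
  fixes f :: "'a::finite + 'b::finite \<Rightarrow> 'c::comm_monoid_add"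
  shows "(\<Sum>x\<in>UNIV. f x) = (\<Sum>i\<in>UNIV. f (Inl i)) + (\<Sum>j\<in>UNIV. f (Inr j))"
  by (simp add: UNIV_Plus_UNIV[symmetric] sum.Plus del: UNIV_Plus_UNIV)

lemma block_bracket:
  "block_A (gl_bracket M N) = block_A M ** block_A N + block_B M ** block_C N
    - (block_A N ** block_A M + block_B N ** block_C M)"
  "block_B (gl_bracket M N) = block_A M ** block_B N + block_B M ** block_D N
    - (block_A N ** block_B M + block_B N ** block_D M)"
  "block_C (gl_bracket M N) = block_C M ** block_A N + block_D M ** block_C N
    - (block_C N ** block_A M + block_D N ** block_C M)"
  "block_D (gl_bracket M N) = block_C M ** block_B N + block_D M ** block_D N
    - (block_C N ** block_B M + block_D N ** block_D M)"
  by (simp_all add: gl_bracket_def block_A_def block_B_def block_C_def block_D_def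
      matrix_matrix_mult_def sum_UNIV_Plus vec_eq_iff)

lemma block_linear:
  "block_A (M + N) = block_A M + block_A N" "block_A (gl_scale c M) = gl_scale c (block_A M)"
  "block_B (M + N) = block_B M + block_B N" "block_B (gl_scale c M) = gl_scale c (block_B M)"
  "block_C (M + N) = block_C M + block_C N" "block_C (gl_scale c M) = gl_scale c (block_C M)"
  "block_D (M + N) = block_D M + block_D N" "block_D (gl_scale c M) = gl_scale c (block_D M)"
  by (simp_all add: block_A_def block_B_def block_C_def block_D_def gl_scale_def vec_eq_iff)

text \<open>
  The blocks on the right are those of the conjugate of \<open>M\<close> by \<open>diag(I, Q\<^sup>-\<^sup>T)\<close>. The factor \<open>tr(F\<^sub>1)\<close>
  to the right of the last trace in the action may be moved inside, since only scalars stand to the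
  right of \<open>\<phi>(a)\<close> there.
\<close>

lemma gl2n_action_eq_block_action:
  "gl2n_action Q M a = block_action (block_A M) (block_B M ** transpose Q)
    (inv_transpose Q ** block_C M) (inv_transpose Q ** block_D M ** transpose Q) a"
proof -
  have T: "trace (M ** mat T ** (1 \<otimes>\<^sub>U X)) = trace (M ** (1 \<otimes>\<^sub>U X)) * T" for M :: "'a ugl_mat" and T X
    by (simp add: trace_def matrix_matrix_mult_def mat_def tensor_def sum_distrib_right
        if_distrib ugl_alg.mul_scl_left ugl_alg.mul_scl_right cong: if_cong)
  show ?thesis
    by (simp add: gl2n_action_def block_action_def trace_\<psi>_def trace_\<phi>_def G_eq matrix_transpose_mul
        matrix_mul_assoc[symmetric] tensor_mult)
      (simp add: matrix_mul_assoc matrix_add_ldistrib mat_add_rdistrib trace_ugl_simps T)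
qed

lemma gl2n_action_linear:
  "gl2n_action Q (M + N) a = gl2n_action Q M a + gl2n_action Q N a"
  "gl2n_action Q (gl_scale c M) a = ugl_scale c (gl2n_action Q M a)"
  "gl2n_action Q M (a + b) = gl2n_action Q M a + gl2n_action Q M b"
  "gl2n_action Q M (ugl_scale c a) = ugl_scale c (gl2n_action Q M a)"
  by (simp_all add: gl2n_action_eq_block_action block_action_def block_linear gl_add_mult
      matrix_add_ldistrib gl_scale_mult_left gl_scale_mult_right \<iota>_add \<iota>_scale distrib_left
      distrib_right ugl_alg.mul_scl_left ugl_alg.mul_scl_right trace_\<psi>_linear trace_\<phi>_linear
      ugl_alg.scale_right_distrib ugl_alg.scale_right_diff_distrib)

theorem theorem18:
  fixes Q :: "complex^'n^'n"
  assumes "invertible Q"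
  shows "gl_module ugl_scale (gl2n_action Q)"
proof -
  have "Q ** matrix_inv Q = mat 1 \<and> matrix_inv Q ** Q = mat 1"
    using assms unfolding invertible_def matrix_inv_def by (rule someI_ex)
  then have "transpose Q ** inv_transpose Q = mat 1"
    by (simp add: inv_transpose_def matrix_transpose_mul[symmetric])
  then have cancel: "X ** transpose Q ** inv_transpose Q = X" for X :: "'n gl"
    by (simp add: matrix_mul_assoc[symmetric])
  have gl_diff: "(X - Y) ** Z = X ** Z - Y ** Z" "Z ** (X - Y) = Z ** X - Z ** Y" for X Y Z :: "'n gl"
    by (simp_all add: matrix_matrix_mult_def vec_eq_iff left_diff_distrib right_diff_distrib sum_subtractf)
  \<comment> \<open>The inner factors \<open>Q\<^sup>T Q\<^sup>-\<^sup>T\<close> cancel in the products of the conjugated blocks.\<close>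
  have bracket: "gl2n_action Q (gl_bracket X Y) a
      = gl2n_action Q X (gl2n_action Q Y a) - gl2n_action Q Y (gl2n_action Q X a)" for X Y a
    unfolding gl2n_action_eq_block_action block_action_bracket[symmetric] block_bracket
    by (simp add: gl_diff gl_add_mult matrix_add_ldistrib matrix_mul_assoc cancel)
  have "vector_space (gl_scale :: _ \<Rightarrow> ('n + 'n) gl \<Rightarrow> _)" "vector_space (ugl_scale :: _ \<Rightarrow> 'n ugl \<Rightarrow> _)"
    by (rule vector_space_gl_scale, unfold_locales)
  then show ?thesis
    unfolding gl_module_def Vector_Spaces.linear_iff
    by (simp add: bracket gl2n_action_linear)
qed

end
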